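(* Let $f:\mathbb{R}^D\to\mathbb{R}$ be continuous, attain its global minimum $f^*$, and have effective dimensionality $d_e\le d$. Let $\boldsymbol{A}$ be a $D\times d$ Gaussian matrix and let $\mu=\min_{\boldsymbol{x}^*\in\mathcal{G}}\|\boldsymbol{x}^*\|_2$. Then, for any $\delta>0$, $$\mathbb{P}[(\mathrm{RP})\text{ is successful}]\;\ge\;1-C(n)\left(1+\frac{n}{2}e^{-\mu^2/(2\delta^2)}\right)\left(\frac{\mu}{\sqrt{2}\,\delta}\right)^n,$$ where $n=d-d_e+1$ and $$C(n)=\frac{4}{n(n+2)\Gamma(n/2)}.$$ Here $(\mathrm{RP})$ is the reduced problem $\min_{\boldsymbol{y}} f(\boldsymbol{A}\boldsymbol{y})$ subject to $\boldsymbol{y}\in\mathcal{Y}=[-\delta,\delta]^d$, and $(\mathrm{RP})$ is called successful if there exists $\boldsymbol{y}^*\in\mathcal{Y}$ such that $f(\boldsymbol{A}\boldsymbol{y}^* )=f^*$.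
   Context: Effective dimensionality: $f:\mathbb{R}^D\to\mathbb{R}$ has effective dimensionality $d_e\le D$ if there is a linear subspace $\mathcal{T}\subseteq\mathbb{R}^D$ of dimension $d_e$ such that $f(\boldsymbol{x}_\top+\boldsymbol{x}_\perp)=f(\boldsymbol{x}_\top)$ for all $\boldsymbol{x}_\top\in\mathcal{T}$ and $\boldsymbol{x}_\perp\in\mathcal{T}^\perp$, and $d_e$ is the smallest integer with this property. $\mathcal{G}=\{\boldsymbol{x}\in\mathbb{R}^D: f(\boldsymbol{x})=f^*\}$ is the set of global minimizers, where $f^*=\min_{\boldsymbol{x}\in\mathbb{R}^D} f(\boldsymbol{x})$. A Gaussian matrix is a random matrix whose entries are independent standard normal random variables. $\Gamma$ is the gamma function. *)

theory Defs
  imports "HOL-Probability.Probability"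
begin

definition varies_only_along :: "(real ^ 'D) set \<Rightarrow> (real ^ 'D \<Rightarrow> real) \<Rightarrow> bool" where
  "varies_only_along T f \<longleftrightarrow>
     subspace T \<and> (\<forall>x\<in>T. \<forall>y\<in>orthogonal_comp T. f (x + y) = f x)"

definition has_effective_dimensionality :: "(real ^ 'D \<Rightarrow> real) \<Rightarrow> nat \<Rightarrow> bool" where
  "has_effective_dimensionality f k \<longleftrightarrow>
     (\<exists>T. varies_only_along T f \<and> dim T = k) \<and>
     (\<forall>j. (\<exists>T. varies_only_along T f \<and> dim T = j) \<longrightarrow> k \<le> j)"

text \<open>The minima below are rendered by \<^const>\<open>Least\<close>, which is meaningful only if the minimum
  is attained.\<close>

definition attains_global_min :: "('a \<Rightarrow> real) \<Rightarrow> bool" where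
  "attains_global_min f \<longleftrightarrow> (\<exists>x. \<forall>y. f x \<le> f y)"

definition global_min :: "('a \<Rightarrow> real) \<Rightarrow> real" where
  "global_min f = (LEAST v. v \<in> range f)"

definition global_minimizers :: "('a \<Rightarrow> real) \<Rightarrow> 'a set" where
  "global_minimizers f = {x. f x = global_min f}"

definition min_norm_minimizer :: "('a::real_normed_vector \<Rightarrow> real) \<Rightarrow> real" where
  "min_norm_minimizer f = (LEAST r. r \<in> norm ` global_minimizers f)"

text \<open>\<^typ>\<open>real ^ 'd ^ 'D\<close> is the type of matrices with \<open>CARD('D)\<close> rows and
  \<open>CARD('d)\<close> columns.\<close>

definition gaussian_matrix :: "'w measure \<Rightarrow> ('w \<Rightarrow> real ^ 'd ^ 'D) \<Rightarrow> bool" where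
  "gaussian_matrix M A \<longleftrightarrow>
     prob_space.indep_vars M (\<lambda>_. borel) (\<lambda>(i, j) \<omega>. A \<omega> $ i $ j) UNIV \<and>
     (\<forall>i j. distributed M lborel (\<lambda>\<omega>. A \<omega> $ i $ j) std_normal_density)"

definition reduced_problem_successful ::
    "(real ^ 'D \<Rightarrow> real) \<Rightarrow> real ^ 'd ^ 'D \<Rightarrow> real \<Rightarrow> bool" where
  "reduced_problem_successful f A \<delta> \<longleftrightarrow>
     (\<exists>y\<in>{y. \<forall>j. y $ j \<in> {-\<delta>..\<delta>}}. f (A *v y) = global_min f)"

definition bound_const :: "nat \<Rightarrow> real" where
  "bound_const n = 4 / (real n * (real n + 2) * Gamma (real n / 2))"

end

theory Submission
  imports Defs
begin

text \<open>Let \<open>x \<in> T\<close> be a minimizer of norm \<open>\<mu>\<close>. It suffices that \<open>A y - x \<in> T\<^sup>\<bottom>\<close> has a solution with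
  \<open>norm y \<le> \<delta>\<close>. With \<open>g = A\<^sup>T x / \<mu>\<close> and \<open>S\<close> the image under \<open>A\<^sup>T\<close> of \<open>{v \<in> T. v \<bullet> x = 0}\<close>, such a
  solution exists as soon as \<open>g\<close> has a projection of norm at least \<open>\<mu> / \<delta>\<close> onto some \<open>n\<close>-dimensional
  subspace of \<open>S\<^sup>\<bottom>\<close>. Since \<open>g\<close> is a standard Gaussian vector independent of \<open>S\<close>, failure has at most
  the probability that an \<open>n\<close>-dimensional standard Gaussian vector lies in the ball of radius
  \<open>\<mu> / \<delta>\<close>; replacing \<open>exp (- s)\<close> by its chord on \<open>[0, \<mu>\<^sup>2 / (2 \<delta>\<^sup>2)]\<close> gives the bound. Independence is
  used by replacing \<open>g\<close> with an independent copy: \<open>(A, g')\<close> is mapped to the modified matrix paired with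
  \<open>g\<close> by an isometry, which preserves the Gaussian measure.\<close>

section \<open>Standard Gaussian measure on a Euclidean space\<close>

text \<open>Finite products of sigma-finite measures are determined by boxes, and over a box the
  integral of a product of one-variable functions factors. Sigma-finiteness of the densities is a
  separate assumption because an arbitrary density can destroy it.\<close>

lemma PiM_density:
  assumes M: "product_sigma_finite M" and D: "product_sigma_finite (\<lambda>i. density (M i) (f i))"
    and fin: "finite I" and f: "\<And>i. i \<in> I \<Longrightarrow> f i \<in> borel_measurable (M i)"
  shows "(\<Pi>\<^sub>M i\<in>I. density (M i) (f i)) = density (PiM I M) (\<lambda>x. \<Prod>i\<in>I. f i (x i))"
proof (rule product_sigma_finite.PiM_eqI[OF D fin, symmetric])
  interpret product_sigma_finite M by fact
  show "sets (density (PiM I M) (\<lambda>x. \<Prod>i\<in>I. f i (x i))) = sets (\<Pi>\<^sub>M i\<in>I. density (M i) (f i))"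
    unfolding sets_density by (rule sets_PiM_cong) simp_all
  fix A assume "\<And>i. i \<in> I \<Longrightarrow> A i \<in> sets (density (M i) (f i))"
  hence A: "A i \<in> sets (M i)" if "i \<in> I" for i
    using that by simp
  have meas: "(\<lambda>x. f i (x i)) \<in> borel_measurable (PiM I M)" if "i \<in> I" for i
    using that f by (auto intro: measurable_compose[OF measurable_component_singleton])
  have "emeasure (density (PiM I M) (\<lambda>x. \<Prod>i\<in>I. f i (x i))) (Pi\<^sub>E I A)
      = (\<integral>\<^sup>+x. (\<Prod>i\<in>I. f i (x i)) * indicator (Pi\<^sub>E I A) x \<partial>PiM I M)"
    using A fin meas
    by (intro emeasure_density sets_PiM_I_finite borel_measurable_prod_ennreal) auto
  also have "\<dots> = (\<integral>\<^sup>+x. (\<Prod>i\<in>I. f i (x i) * indicator (A i) (x i)) \<partial>PiM I M)"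
  proof (intro nn_integral_cong)
    fix x assume "x \<in> space (PiM I M)"
    hence "indicator (Pi\<^sub>E I A) x = (\<Prod>i\<in>I. indicator (A i) (x i) :: ennreal)"
      using fin by (auto simp: indicator_def space_PiM PiE_iff prod_zero_iff)
    thus "(\<Prod>i\<in>I. f i (x i)) * indicator (Pi\<^sub>E I A) x = (\<Prod>i\<in>I. f i (x i) * indicator (A i) (x i))"
      by (simp add: prod.distrib)
  qed
  also have "\<dots> = (\<Prod>i\<in>I. \<integral>\<^sup>+x. f i x * indicator (A i) x \<partial>M i)"
    using fin f A by (intro product_nn_integral_prod) auto
  also have "\<dots> = (\<Prod>i\<in>I. emeasure (density (M i) (f i)) (A i))"
    using f A by (intro prod.cong) (auto simp: emeasure_density)
  finally show "emeasure (density (PiM I M) (\<lambda>x. \<Prod>i\<in>I. f i (x i))) (Pi\<^sub>E I A) = \<dots>" .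
qed

abbreviation std_normal :: "real measure" where
  "std_normal \<equiv> density lborel std_normal_density"

text \<open>The isotropic form of the density is chosen over a product of coordinate laws, so that
  invariance under isometries reduces to that of \<open>lborel\<close>.\<close>

definition std_gaussian :: "'a::euclidean_space measure" where
  "std_gaussian = density lborel (\<lambda>x. ennreal ((1 / sqrt (2 * pi)) ^ DIM('a) * exp (- (norm x)\<^sup>2 / 2)))"

lemma sets_std_gaussian [simp, measurable_cong]: "sets std_gaussian = sets borel"
  by (simp add: std_gaussian_def)

lemma space_std_gaussian [simp]: "space std_gaussian = UNIV"
  by (simp add: std_gaussian_def)

lemma prod_std_normal_density:
  "(\<Prod>i\<in>J. std_normal_density (f i)) = (1 / sqrt (2 * pi)) ^ card J * exp (- (\<Sum>i\<in>J. (f i)\<^sup>2) / 2)"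
proof (cases "finite J")
  case True
  have "exp (- (\<Sum>i\<in>J. (f i)\<^sup>2) / 2) = (\<Prod>i\<in>J. exp (- (f i)\<^sup>2 / 2))"
    using True by (simp add: exp_sum[symmetric] sum_negf sum_divide_distrib)
  thus ?thesis
    by (simp add: std_normal_density_def prod.distrib prod_dividef power_divide)
qed simp

lemma PiM_std_normal:
  assumes "finite J"
  shows "(\<Pi>\<^sub>M i\<in>J. std_normal) = density (\<Pi>\<^sub>M i\<in>J. lborel)
           (\<lambda>f. ennreal ((1 / sqrt (2 * pi)) ^ card J * exp (- (\<Sum>i\<in>J. (f i)\<^sup>2) / 2)))"
proof -
  interpret N: prob_space std_normal by (rule prob_space_normal_density) simp
  have 1: "product_sigma_finite (\<lambda>_. lborel :: real measure)"
    by standard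
  have 2: "product_sigma_finite (\<lambda>_. std_normal)"
    by standard
  have "(\<Pi>\<^sub>M i\<in>J. std_normal)
      = density (\<Pi>\<^sub>M i\<in>J. lborel) (\<lambda>f. \<Prod>i\<in>J. ennreal (std_normal_density (f i)))"
    using PiM_density[OF 1 2 assms] by simp
  also have "\<dots> = density (\<Pi>\<^sub>M i\<in>J. lborel)
     (\<lambda>f. ennreal ((1 / sqrt (2 * pi)) ^ card J * exp (- (\<Sum>i\<in>J. (f i)\<^sup>2) / 2)))"
    by (simp add: prod_ennreal prod_std_normal_density)
  finally show ?thesis .
qed

lemma norm_sum_Basis_squared:
  fixes f :: "'a::euclidean_space \<Rightarrow> real"
  shows "(norm (\<Sum>b\<in>Basis. f b *\<^sub>R b))\<^sup>2 = (\<Sum>b\<in>Basis. (f b)\<^sup>2)"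
proof -
  let ?x = "\<Sum>b\<in>Basis. f b *\<^sub>R b"
  have "(norm ?x)\<^sup>2 = (\<Sum>b\<in>Basis. (?x \<bullet> b) * (?x \<bullet> b))"
    unfolding power2_norm_eq_inner by (rule euclidean_inner)
  also have "\<dots> = (\<Sum>b\<in>Basis. (f b)\<^sup>2)"
    by (intro sum.cong refl) (simp only: inner_sum_left_Basis power2_eq_square)
  finally show ?thesis .
qed

text \<open>The squared norm is the sum of the squared coordinates, so the isotropic density is a
  product of one-dimensional ones. This makes total mass one and independence of coordinates
  available.\<close>

lemma std_gaussian_eq_distr_PiM:
  "std_gaussian = distr (\<Pi>\<^sub>M b\<in>Basis. std_normal) borel (\<lambda>f. \<Sum>b\<in>Basis. f b *\<^sub>R b)"
  unfolding std_gaussian_def PiM_std_normal[OF finite_Basis]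
  by (subst lborel_eq, subst density_distr) (measurable, simp only: norm_sum_Basis_squared)

lemma prob_space_std_gaussian: "prob_space std_gaussian"
proof -
  have "prob_space (\<Pi>\<^sub>M b\<in>(Basis :: 'a set). std_normal)"
    by (intro prob_space_PiM prob_space_normal_density) simp
  thus ?thesis
    unfolding std_gaussian_eq_distr_PiM by (rule prob_space.prob_space_distr) measurable
qed

section \<open>Rotation invariance\<close>

lemma emeasure_lborel_translation:
  fixes x :: "'a::euclidean_space"
  assumes [measurable]: "A \<in> sets borel"
  shows "emeasure lborel {y. x + y \<in> A} = emeasure lborel A"
proof -
  have "lborel = distr lborel borel ((+) x)"
    using lborel_affine[of 1 x] by (simp add: density_1)
  hence "emeasure lborel A = emeasure (distr lborel borel ((+) x)) A" by simp
  thus ?thesis by (simp add: emeasure_distr vimage_def)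
qed

text \<open>Uniqueness of a translation-invariant measure: \<open>lborel A * M B\<close> and \<open>M A * lborel B\<close>
  are both the \<open>lborel \<Otimes>\<^sub>M M\<close>-measure of the same set up to a reflection and a shear.\<close>

lemma translation_invariant_measure_eq_lborel:
  fixes M :: "'a::euclidean_space measure"
  assumes "sigma_finite_measure M" and sets: "sets M = sets borel"
    and inv: "\<And>x A. A \<in> sets borel \<Longrightarrow> emeasure M {y. x + y \<in> A} = emeasure M A"
    and ball: "emeasure M (ball 0 1) = emeasure lborel (ball (0::'a) 1)"
  shows "M = lborel"
proof (rule measure_eqI)
  interpret M: sigma_finite_measure M by fact
  interpret P: pair_sigma_finite lborel M ..
  note [measurable_cong] = sets
  have spM [simp]: "space M = UNIV"
    using sets_eq_imp_space_eq[OF sets] by simp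
  have key: "emeasure lborel B * emeasure M A = emeasure lborel {y. - y \<in> A} * emeasure M B"
    if [measurable]: "A \<in> sets borel" "B \<in> sets borel" for A B
  proof -
    have "(\<integral>\<^sup>+y. \<integral>\<^sup>+x. indicator A x * indicator B (x + y) \<partial>M \<partial>lborel)
        = (\<integral>\<^sup>+x. \<integral>\<^sup>+y. indicator A x * indicator B (x + y) \<partial>lborel \<partial>M)"
      by (subst P.Fubini') auto
    also have "\<dots> = (\<integral>\<^sup>+x. indicator A x * emeasure lborel {y. x + y \<in> B} \<partial>M)"
      by (subst nn_integral_cmult)
         (auto intro!: nn_integral_cong arg_cong2[where f = "(*)"]
               simp flip: nn_integral_indicator simp: indicator_def)
    also have "\<dots> = emeasure lborel B * emeasure M A"
      by (simp add: emeasure_lborel_translation nn_integral_multc nn_integral_indicator sets mult.commute)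
    finally have 1: "(\<integral>\<^sup>+y. \<integral>\<^sup>+x. indicator A x * indicator B (x + y) \<partial>M \<partial>lborel)
      = emeasure lborel B * emeasure M A" .
    \<comment> \<open>For fixed \<open>y\<close>, invariance of \<open>M\<close> moves the shift
      from \<open>B\<close> to \<open>A\<close>; integrating over \<open>y\<close> first then yields
      the volume of a translate of the reflection of \<open>A\<close>.\<close>
    have shift: "(\<integral>\<^sup>+x. indicator A x * indicator B (x + y) \<partial>M)
        = (\<integral>\<^sup>+x. indicator A (x - y) * indicator B x \<partial>M)" for y
    proof -
      have "(\<integral>\<^sup>+x. indicator A x * indicator B (x + y) \<partial>M)
          = (\<integral>\<^sup>+x. indicator {x. y + x \<in> {z \<in> B. z - y \<in> A}} x \<partial>M)"
        by (intro nn_integral_cong) (auto simp: indicator_def add.commute)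
      also have "\<dots> = emeasure M {x. y + x \<in> {z \<in> B. z - y \<in> A}}"
        by (intro nn_integral_indicator) (simp add: sets)
      also have "\<dots> = emeasure M {z \<in> B. z - y \<in> A}"
        by (rule inv) measurable
      also have "\<dots> = (\<integral>\<^sup>+x. indicator A (x - y) * indicator B x \<partial>M)"
        by (subst nn_integral_indicator[symmetric], simp add: sets)
           (intro nn_integral_cong, auto simp: indicator_def)
      finally show ?thesis .
    qed
    have "(\<integral>\<^sup>+y. \<integral>\<^sup>+x. indicator A x * indicator B (x + y) \<partial>M \<partial>lborel)
        = (\<integral>\<^sup>+y. \<integral>\<^sup>+x. indicator A (x - y) * indicator B x \<partial>M \<partial>lborel)"
      by (simp add: shift)
    also have "\<dots> = (\<integral>\<^sup>+x. \<integral>\<^sup>+y. indicator A (x - y) * indicator B x \<partial>lborel \<partial>M)"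
      by (subst P.Fubini') auto
    also have "\<dots> = (\<integral>\<^sup>+x. emeasure lborel {y. (- x) + y \<in> {y. - y \<in> A}} * indicator B x \<partial>M)"
      by (subst nn_integral_multc)
         (auto intro!: nn_integral_cong arg_cong2[where f = "(*)"]
               simp flip: nn_integral_indicator simp: indicator_def)
    also have "\<dots> = emeasure lborel {y. - y \<in> A} * emeasure M B"
      by (subst emeasure_lborel_translation)
         (auto simp: nn_integral_cmult nn_integral_indicator sets)
    finally show ?thesis using 1 by simp
  qed
  show "sets M = sets lborel" using sets by simp
  fix A assume "A \<in> sets M"
  hence [measurable]: "A \<in> sets borel" by (simp add: sets)
  have pos: "0 < emeasure lborel (ball (0::'a) 1)"
    by (simp add: emeasure_ball)
  have fin: "emeasure lborel (ball (0::'a) 1) < \<infinity>"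
    using emeasure_bounded_finite[of "ball (0::'a) 1"] by simp
  \<comment> \<open>With the ball as first set in \<open>key\<close>, the reflection is harmless by
    symmetry, and its positive finite volume can be cancelled.\<close>
  have "ball (0::'a) 1 = {y. - y \<in> ball (0::'a) 1}" by auto
  hence "emeasure lborel A * emeasure M (ball 0 1) = emeasure lborel (ball (0::'a) 1) * emeasure M A"
    using key[of "ball 0 1" A] by simp
  hence "emeasure lborel (ball (0::'a) 1) * emeasure M A = emeasure lborel (ball (0::'a) 1) * emeasure lborel A"
    by (simp add: ball mult.commute)
  thus "emeasure M A = emeasure lborel A"
    using pos fin by (auto simp: ennreal_mult_cancel_left)
qed

text \<open>Since \<open>x + Q y = Q (x' + y)\<close> for the preimage \<open>x'\<close> of
  \<open>x\<close>, the image measure is translation invariant. As \<open>Q\<close> preserves norms,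
  centred balls are their own preimages, which gives both the normalization and
  sigma-finiteness.\<close>

lemma distr_lborel_orthogonal_transformation:
  fixes Q :: "'a::euclidean_space \<Rightarrow> 'a"
  assumes Q: "orthogonal_transformation Q"
  shows "distr lborel borel Q = lborel"
proof (rule translation_invariant_measure_eq_lborel)
  have lin: "linear Q" and bij: "bij Q"
    using Q orthogonal_transformation_linear orthogonal_transformation_bij by auto
  have [measurable]: "Q \<in> borel_measurable borel"
    using lin by (intro borel_measurable_continuous_onI linear_continuous_on)
                 (simp add: linear_conv_bounded_linear)
  have nrm: "norm (Q x) = norm x" for x
    using Q by (simp add: orthogonal_transformation)
  show "emeasure (distr lborel borel Q) {y. x + y \<in> A} = emeasure (distr lborel borel Q) A"
    if [measurable]: "A \<in> sets borel" for x A
  proof -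
    obtain x' where x': "x = Q x'" using bij by (metis bij_pointE)
    have "emeasure (distr lborel borel Q) {y. x + y \<in> A} = emeasure lborel {y. x' + y \<in> Q -` A}"
      by (subst emeasure_distr) (auto simp: vimage_def x' linear_add[OF lin])
    also have "\<dots> = emeasure lborel (Q -` A)"
      by (rule emeasure_lborel_translation) (use measurable_sets[of Q borel borel A] in simp)
    finally show ?thesis by (simp add: emeasure_distr)
  qed
  have pre: "Q -` ball 0 1 = ball 0 1"
    by (auto simp: nrm)
  show "emeasure (distr lborel borel Q) (ball 0 1) = emeasure lborel (ball (0::'a) 1)"
    by (simp add: emeasure_distr pre)
  show "sigma_finite_measure (distr lborel borel Q)"
  proof
    let ?B = "\<lambda>n::nat. ball (0::'a) (real n)"
    have pre: "Q -` ?B n = ?B n" for n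
      by (auto simp: nrm)
    have "emeasure (distr lborel borel Q) (?B n) \<noteq> \<infinity>" for n
      using emeasure_bounded_finite[of "?B n"] by (simp add: emeasure_distr pre)
    moreover have "(\<Union>n. ?B n) = UNIV"
      by (auto intro: reals_Archimedean2)
    ultimately show "\<exists>A. countable A \<and> A \<subseteq> sets (distr lborel borel Q) \<and>
        \<Union>A = space (distr lborel borel Q) \<and> (\<forall>a\<in>A. emeasure (distr lborel borel Q) a \<noteq> \<infinity>)"
      by (intro exI[of _ "range ?B"]) auto
  qed
qed simp

lemma distr_std_gaussian_orthogonal_transformation:
  fixes Q :: "'a::euclidean_space \<Rightarrow> 'a"
  assumes Q: "orthogonal_transformation Q"
  shows "distr std_gaussian borel Q = std_gaussian"
proof -
  have [measurable]: "Q \<in> borel_measurable borel"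
    using orthogonal_transformation_linear[OF Q]
    by (intro borel_measurable_continuous_onI linear_continuous_on)
       (simp add: linear_conv_bounded_linear)
  have "norm (Q x) = norm x" for x
    using Q by (simp add: orthogonal_transformation)
  moreover have "std_gaussian = density (distr lborel borel Q)
     (\<lambda>x. ennreal ((1 / sqrt (2 * pi)) ^ DIM('a) * exp (- (norm x)\<^sup>2 / 2)))"
    unfolding std_gaussian_def by (simp add: distr_lborel_orthogonal_transformation[OF Q])
  ultimately show ?thesis
    by (simp add: density_distr std_gaussian_def)
qed

text \<open>Squared norms add over a product space and dimensions add too, so the density
  factors.\<close>

lemma std_gaussian_prod:
  "(std_gaussian :: ('a::euclidean_space \<times> 'b::euclidean_space) measure) = std_gaussian \<Otimes>\<^sub>M std_gaussian"
proof -
  interpret P: prob_space "std_gaussian :: 'b measure" by (rule prob_space_std_gaussian)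
  show ?thesis
    unfolding std_gaussian_def
    apply (subst pair_measure_density)
    subgoal by simp
    subgoal by simp
    subgoal by standard
    subgoal unfolding std_gaussian_def[symmetric] by standard
    subgoal
      unfolding lborel_prod
      by (intro arg_cong[where f = "density lborel"] ext)
         (auto simp: norm_prod_def power_add exp_add[symmetric] field_simps simp flip: ennreal_mult)
    done
qed

section \<open>Gaussian measure of balls and of cylinders over balls\<close>

text \<open>Convexity of \<open>exp\<close>. The chord is written as a constant plus a multiple of
  \<open>z - s\<close>, a term that vanishes at the far end and can be integrated by layers.\<close>

lemma exp_minus_le_chord:
  fixes s z :: real
  assumes "0 \<le> s" "s \<le> z" "0 < z"
  shows "exp (- s) \<le> exp (- z) + (1 - exp (- z)) * ((z - s) / z)"
proof -
  have "convex_on UNIV (exp :: real \<Rightarrow> real)"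
    by (rule exp_convex)
  hence "exp ((1 - s / z) *\<^sub>R 0 + (s / z) *\<^sub>R (- z)) \<le> (1 - s / z) * exp 0 + (s / z) * exp (- z)"
    using assms by (intro convex_onD) auto
  moreover have "(1 - exp (- z)) * ((z - s) / z) = 1 - s / z - (1 - s / z) * exp (- z)"
    using assms by (simp add: field_simps)
  ultimately show ?thesis
    using assms by (simp add: algebra_simps)
qed

lemma nn_integral_two_mult:
  fixes r t :: real
  assumes "0 \<le> r" "r \<le> t"
  shows "(\<integral>\<^sup>+s. ennreal (2 * s) * indicator {r..t} s \<partial>lborel) = ennreal (t\<^sup>2 - r\<^sup>2)"
  using assms by (intro nn_integral_FTC_Icc) (auto intro!: derivative_eq_intros)

lemma nn_integral_power_Icc:
  fixes t :: real
  assumes "0 \<le> t"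
  shows "(\<integral>\<^sup>+s. ennreal (s ^ k) * indicator {0..t} s \<partial>lborel) = ennreal (t ^ Suc k / real (Suc k))"
proof -
  have "(\<integral>\<^sup>+s. ennreal (s ^ k) * indicator {0..t} s \<partial>lborel)
      = ennreal (t ^ Suc k / real (Suc k) - 0 ^ Suc k / real (Suc k))"
    using assms
    by (intro nn_integral_FTC_Icc)
       (auto intro!: DERIV_cong[OF DERIV_cdivide[OF DERIV_pow]] simp del: power_Suc of_nat_Suc)
  thus ?thesis by simp
qed

text \<open>On the ball, the chord bound majorizes the density by a constant plus a multiple of
  \<open>t^2 - r^2\<close>, where \<open>r\<close> is the norm of the point. Writing
  \<open>t^2 - r^2\<close> as the integral of \<open>2 * s\<close> over \<open>s\<close> from
  \<open>r\<close> to \<open>t\<close> and exchanging integrals leaves only volumes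
  \<open>V * s ^ n\<close> of balls.\<close>

lemma emeasure_PiM_std_normal_ball_aux:
  fixes t :: real
  assumes J: "finite J" and t: "t > 0"
  defines "n \<equiv> card J"
  defines "S \<equiv> \<lambda>r. {f \<in> space (\<Pi>\<^sub>M i\<in>J. lborel). sqrt (\<Sum>i\<in>J. (f i)\<^sup>2) \<le> r}"
  defines "E \<equiv> exp (- (t\<^sup>2 / 2))" and "V \<equiv> unit_ball_vol (real n)" and "c \<equiv> (1 / sqrt (2 * pi)) ^ n"
  shows "emeasure (\<Pi>\<^sub>M i\<in>J. std_normal) (S t)
      \<le> ennreal (c * (E * (V * t ^ n) + (1 - E) / t\<^sup>2 * (2 * V * (t ^ Suc (Suc n) / real (Suc (Suc n))))))"
proof -
  let ?L = "\<Pi>\<^sub>M i\<in>J. (lborel :: real measure)"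
  let ?q = "\<lambda>f. \<Sum>i\<in>J. (f i)\<^sup>2"
  interpret product_sigma_finite "\<lambda>_. lborel :: real measure" ..
  interpret L: sigma_finite_measure ?L by (rule sigma_finite[OF J])
  interpret P: pair_sigma_finite "lborel :: real measure" ?L ..
  have S_sets [measurable]: "S r \<in> sets ?L" for r
    unfolding S_def by measurable
  have S_vol: "emeasure ?L (S r) = ennreal (V * r ^ n)" if "r > 0" for r
    using emeasure_cball_aux[OF J that] by (simp add: S_def V_def n_def Int_def conj_commute)
  have E: "0 < E" "E \<le> 1" and c: "c > 0" and V: "V > 0"
    by (auto simp: E_def c_def V_def)
  \<comment> \<open>Fubini needs measurability jointly in the radius and the point.\<close>
  have S_pair [measurable]: "(\<lambda>(s, f). indicator (S s) f :: ennreal) \<in> borel_measurable (lborel \<Otimes>\<^sub>M ?L)"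
  proof -
    have "(\<lambda>(s, f). indicator {p \<in> space (lborel \<Otimes>\<^sub>M ?L). sqrt (?q (snd p)) \<le> fst p} (s, f) :: ennreal)
        \<in> borel_measurable (lborel \<Otimes>\<^sub>M ?L)"
      by measurable
    also have "?this \<longleftrightarrow> ?thesis"
      by (intro measurable_cong) (auto simp: S_def indicator_def space_pair_measure)
    finally show ?thesis .
  qed
  have pointwise: "ennreal (c * exp (- ?q f / 2)) * indicator (S t) f
      \<le> ennreal c * (ennreal E * indicator (S t) f +
          ennreal ((1 - E) / t\<^sup>2) * (\<integral>\<^sup>+s. ennreal (2 * s) * indicator {0..t} s * indicator (S s) f \<partial>lborel))"
    if f: "f \<in> space ?L" for f
  proof (cases "f \<in> S t")
    case True
    define r where "r = sqrt (?q f)"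
    have r: "0 \<le> r" "r \<le> t" "r\<^sup>2 = ?q f"
      using True by (auto simp: r_def S_def sum_nonneg)
    have "(\<integral>\<^sup>+s. ennreal (2 * s) * indicator {0..t} s * indicator (S s) f \<partial>lborel)
        = (\<integral>\<^sup>+s. ennreal (2 * s) * indicator {r..t} s \<partial>lborel)"
      using r f by (intro nn_integral_cong) (auto simp: indicator_def S_def r_def ennreal_neg)
    also have "\<dots> = ennreal (t\<^sup>2 - r\<^sup>2)"
      using nn_integral_two_mult r by blast
    finally have int: "(\<integral>\<^sup>+s. ennreal (2 * s) * indicator {0..t} s * indicator (S s) f \<partial>lborel)
        = ennreal (t\<^sup>2 - r\<^sup>2)" .
    have le: "r\<^sup>2 \<le> t\<^sup>2" using r by (intro power_mono) auto
    have "exp (- (r\<^sup>2 / 2)) \<le> E + (1 - E) * ((t\<^sup>2 / 2 - r\<^sup>2 / 2) / (t\<^sup>2 / 2))"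
      unfolding E_def using le t by (intro exp_minus_le_chord) auto
    also have "(t\<^sup>2 / 2 - r\<^sup>2 / 2) / (t\<^sup>2 / 2) = (t\<^sup>2 - r\<^sup>2) / t\<^sup>2"
      using t by (simp add: field_simps)
    finally have "c * exp (- ?q f / 2) \<le> c * (E + (1 - E) / t\<^sup>2 * (t\<^sup>2 - r\<^sup>2))"
      using c r by (intro mult_left_mono) auto
    thus ?thesis
      using True E c le by (simp add: int ennreal_mult' ennreal_plus ennreal_leI flip: ennreal_plus ennreal_mult')
  qed simp
  have "emeasure (\<Pi>\<^sub>M i\<in>J. std_normal) (S t)
      = (\<integral>\<^sup>+f. ennreal (c * exp (- ?q f / 2)) * indicator (S t) f \<partial>?L)"
    unfolding PiM_std_normal[OF J] c_def n_def by (subst emeasure_density) auto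
  also have "\<dots> \<le> (\<integral>\<^sup>+f. ennreal c * (ennreal E * indicator (S t) f +
          ennreal ((1 - E) / t\<^sup>2) * (\<integral>\<^sup>+s. ennreal (2 * s) * indicator {0..t} s * indicator (S s) f \<partial>lborel)) \<partial>?L)"
    by (intro nn_integral_mono pointwise)
  also have "\<dots> = ennreal c * (ennreal E * emeasure ?L (S t) + ennreal ((1 - E) / t\<^sup>2) *
      (\<integral>\<^sup>+f. \<integral>\<^sup>+s. ennreal (2 * s) * indicator {0..t} s * indicator (S s) f \<partial>lborel \<partial>?L))"
    by (simp add: nn_integral_cmult nn_integral_add)
  also have "(\<integral>\<^sup>+f. \<integral>\<^sup>+s. ennreal (2 * s) * indicator {0..t} s * indicator (S s) f \<partial>lborel \<partial>?L)
      = (\<integral>\<^sup>+s. \<integral>\<^sup>+f. ennreal (2 * s) * indicator {0..t} s * indicator (S s) f \<partial>?L \<partial>lborel)"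
    by (intro P.Fubini') measurable
  also have "\<dots> = (\<integral>\<^sup>+s. ennreal (2 * V) * (ennreal (s ^ Suc n) * indicator {0..t} s) \<partial>lborel)"
  proof (intro nn_integral_cong)
    fix s :: real
    have "(\<integral>\<^sup>+f. ennreal (2 * s) * indicator {0..t} s * indicator (S s) f \<partial>?L)
        = ennreal (2 * s) * indicator {0..t} s * emeasure ?L (S s)"
      by (simp add: nn_integral_cmult)
    also have "\<dots> = ennreal (2 * V) * (ennreal (s ^ Suc n) * indicator {0..t} s)"
    \<comment> \<open>The volume formula needs a positive radius; at 0 the factor \<open>s\<close>
      makes both sides vanish, and below 0 the indicator does.\<close>
    proof (cases "s > 0")
      case True
      thus ?thesis using V
        by (simp add: S_vol indicator_def mult_ac flip: ennreal_mult')
    next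
      case False
      thus ?thesis by (cases "s = 0") (auto simp: indicator_def)
    qed
    finally show "(\<integral>\<^sup>+f. ennreal (2 * s) * indicator {0..t} s * indicator (S s) f \<partial>?L) = \<dots>" .
  qed
  also have "\<dots> = ennreal (2 * V) * ennreal (t ^ Suc (Suc n) / real (Suc (Suc n)))"
    using t by (subst nn_integral_cmult) (auto simp del: power_Suc of_nat_Suc simp: nn_integral_power_Icc)
  also have "ennreal c * (ennreal E * emeasure ?L (S t) + ennreal ((1 - E) / t\<^sup>2) * \<dots>)
      = ennreal (c * (E * (V * t ^ n) + (1 - E) / t\<^sup>2 * (2 * V * (t ^ Suc (Suc n) / real (Suc (Suc n))))))"
    using c E V t
    by (simp add: S_vol[OF t] ennreal_mult ennreal_plus del: power_Suc of_nat_Suc times_divide_eq_left times_divide_eq_right)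
  finally show ?thesis .
qed

text \<open>Two identities produce \<open>bound_const\<close>:
  \<open>V = pi powr (n / 2) / Gamma (n / 2 + 1)\<close> evaluates \<open>c * V\<close>, and
  \<open>E + 2 * (1 - E) / (n + 2)\<close> equals \<open>2 / (n + 2) * (1 + n / 2 * E)\<close>.
  Nonemptiness of \<open>J\<close> gives \<open>n > 0\<close> for the recurrence of
  \<open>Gamma\<close>.\<close>

lemma emeasure_PiM_std_normal_ball:
  fixes t :: real
  assumes J: "finite J" "J \<noteq> {}" and t: "t > 0"
  defines "n \<equiv> card J"
  shows "emeasure (\<Pi>\<^sub>M i\<in>J. std_normal)
           {f \<in> space (\<Pi>\<^sub>M i\<in>J. lborel). sqrt (\<Sum>i\<in>J. (f i)\<^sup>2) \<le> t}
      \<le> ennreal (bound_const n * (1 + real n / 2 * exp (- (t\<^sup>2 / 2))) * (t / sqrt 2) ^ n)"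
proof -
  have n: "n > 0" using J by (simp add: n_def card_gt_0_iff)
  define E where "E = exp (- (t\<^sup>2 / 2))"
  define V where "V = unit_ball_vol (real n)"
  define c where "c = (1 / sqrt (2 * pi)) ^ n"
  have cV: "c * V = 2 / (real n * Gamma (real n / 2)) * (1 / sqrt 2) ^ n"
  proof -
    have "pi powr (real n / 2) = sqrt pi ^ n"
      by (simp add: powr_half_sqrt[symmetric] powr_powr flip: powr_realpow)
    moreover have "Gamma (real n / 2 + 1) = real n / 2 * Gamma (real n / 2)"
      using n by (intro Gamma_plus1) (auto dest: nonpos_Ints_nonpos)
    ultimately show ?thesis
      by (simp only: c_def V_def unit_ball_vol_def)
         (simp add: real_sqrt_mult power_divide power_mult_distrib)
  qed
  have "c * (E * (V * t ^ n) + (1 - E) / t\<^sup>2 * (2 * V * (t ^ Suc (Suc n) / real (Suc (Suc n)))))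
      = (c * V) * t ^ n * (E + (1 - E) * 2 / (real n + 2))"
  proof -
    have "t ^ Suc (Suc n) = t\<^sup>2 * t ^ n"
      by (simp add: power2_eq_square)
    hence "(1 - E) / t\<^sup>2 * (2 * V * (t ^ Suc (Suc n) / real (Suc (Suc n))))
        = (1 - E) * (2 * V * (t ^ n / (real n + 2)))"
      using t by (simp add: add.commute del: power_Suc)
    thus ?thesis by (simp add: algebra_simps)
  qed
  also have "E + (1 - E) * 2 / (real n + 2) = 2 / (real n + 2) * (1 + real n / 2 * E)"
    by (simp add: field_simps)
  also have "(c * V) * t ^ n * (2 / (real n + 2) * (1 + real n / 2 * E))
      = bound_const n * (1 + real n / 2 * E) * (t / sqrt 2) ^ n"
  proof -
    have "(1 / sqrt 2) ^ n * t ^ n = (t / sqrt 2) ^ n"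
      by (simp add: power_divide)
    hence "(c * V) * t ^ n = 2 / (real n * Gamma (real n / 2)) * (t / sqrt 2) ^ n"
      unfolding cV by (simp only: mult.assoc)
    moreover have "bound_const n = 2 / (real n * Gamma (real n / 2)) * (2 / (real n + 2))"
      by (simp add: bound_const_def mult_ac)
    ultimately show ?thesis
      by (simp only: mult_ac)
  qed
  finally show ?thesis
    using emeasure_PiM_std_normal_ball_aux[OF J(1) t, folded n_def, folded E_def V_def c_def]
    by (simp add: E_def)
qed

section \<open>Orthonormal changes of basis and cylinders over balls\<close>

lemma orthonormal_basis_extension:
  fixes O1 :: "'a::euclidean_space set"
  assumes "pairwise orthogonal O1" "\<And>v. v \<in> O1 \<Longrightarrow> norm v = 1"
  obtains B where "O1 \<subseteq> B" "pairwise orthogonal B" "\<And>v. v \<in> B \<Longrightarrow> norm v = 1" "finite B" "card B = DIM('a)"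
proof -
  define W where "W = {y. \<forall>x\<in>span O1. orthogonal x y}"
  have subW: "subspace W"
    unfolding W_def subspace_def by (auto simp: orthogonal_clauses)
  obtain O2 where O2: "O2 \<subseteq> W" "pairwise orthogonal O2" "\<And>v. v \<in> O2 \<Longrightarrow> norm v = 1"
    "independent O2" "card O2 = dim W"
    using orthonormal_basis_subspace[OF subW] by metis
  have 0: "0 \<notin> O1" using assms(2) by force
  hence ind: "independent O1" using assms(1) pairwise_orthogonal_independent by blast
  have fin: "finite O1" "finite O2"
    using ind O2 independent_imp_finite by auto
  have cross: "orthogonal v w" if "v \<in> O1" "w \<in> O2" for v w
    using that O2(1) span_base by (auto simp: W_def)
  have disj: "O1 \<inter> O2 = {}"
    using cross assms(2) by (metis disjoint_iff norm_zero orthogonal_self zero_neq_one)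
  have "dim W + dim (span O1) = dim (UNIV :: 'a set)"
    using dim_subspace_orthogonal_to_vectors[of "span O1" UNIV] by (simp add: W_def)
  hence "card (O1 \<union> O2) = DIM('a)"
    using fin disj O2(5) ind by (simp add: card_Un_disjoint dim_eq_card_independent)
  moreover have "pairwise orthogonal (O1 \<union> O2)"
    using assms(1) O2(2) cross by (auto simp: pairwise_def) (metis orthogonal_commute)
  ultimately show ?thesis
    using assms(2) O2(3) fin by (intro that[of "O1 \<union> O2"]) auto
qed

lemma orthogonal_transformation_Basis_image:
  fixes h :: "'a::euclidean_space \<Rightarrow> 'a"
  assumes h: "\<And>b. b \<in> Basis \<Longrightarrow> norm (h b) = 1"
    and orth: "\<And>b c. b \<in> Basis \<Longrightarrow> c \<in> Basis \<Longrightarrow> b \<noteq> c \<Longrightarrow> orthogonal (h b) (h c)"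
  defines "Q \<equiv> \<lambda>x. \<Sum>b\<in>Basis. (x \<bullet> b) *\<^sub>R h b"
  shows "orthogonal_transformation Q" and "\<And>x b. b \<in> Basis \<Longrightarrow> Q x \<bullet> h b = x \<bullet> b"
proof -
  have "linear Q"
    unfolding Q_def
    by (intro linearI) (simp_all add: inner_add_left scaleR_add_left sum.distrib scaleR_sum_right)
  moreover have "norm (Q x) = norm x" for x
  proof -
    have "(norm (Q x))\<^sup>2 = (\<Sum>b\<in>Basis. (norm ((x \<bullet> b) *\<^sub>R h b))\<^sup>2)"
      unfolding Q_def
      by (rule norm_sum_Pythagorean) (auto simp: pairwise_def orthogonal_clauses orth)
    also have "\<dots> = (\<Sum>b\<in>Basis. (x \<bullet> b) * (x \<bullet> b))"
      by (intro sum.cong) (auto simp: h power2_eq_square)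
    also have "\<dots> = (norm x)\<^sup>2"
      unfolding power2_norm_eq_inner by (rule euclidean_inner[symmetric])
    finally show ?thesis by simp
  qed
  ultimately show "orthogonal_transformation Q"
    by (simp add: orthogonal_transformation)
  fix x b :: 'a assume b: "b \<in> Basis"
  have "Q x \<bullet> h b = (\<Sum>c\<in>Basis. (x \<bullet> c) * (h c \<bullet> h b))"
    by (simp add: Q_def inner_sum_left)
  also have "\<dots> = (\<Sum>c\<in>Basis. if c = b then x \<bullet> c else 0)"
    using b h orth by (intro sum.cong) (auto simp: orthogonal_def norm_eq_1)
  finally show "Q x \<bullet> h b = x \<bullet> b"
    using b by simp
qed

text \<open>Complete \<open>B\<close> to an orthonormal basis and rotate that basis onto the
  standard one: the cylinder then constrains only \<open>card B\<close> coordinates of a product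
  measure, and the ball estimate applies to them.\<close>

lemma emeasure_std_gaussian_projection_le:
  fixes B :: "'a::euclidean_space set"
  assumes B: "pairwise orthogonal B" "\<And>v. v \<in> B \<Longrightarrow> norm v = 1" "B \<noteq> {}" and t: "t > 0"
  defines "n \<equiv> card B"
  shows "emeasure std_gaussian {x. sqrt (\<Sum>v\<in>B. (x \<bullet> v)\<^sup>2) \<le> t}
      \<le> ennreal (bound_const n * (1 + real n / 2 * exp (- (t\<^sup>2 / 2))) * (t / sqrt 2) ^ n)"
proof -
  obtain C where C: "B \<subseteq> C" "pairwise orthogonal C" "\<And>v. v \<in> C \<Longrightarrow> norm v = 1" "finite C" "card C = DIM('a)"
    using orthonormal_basis_extension[OF B(1,2)] by metis
  obtain h where h: "bij_betw h (Basis :: 'a set) C"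
    using C(4,5) by (metis finite_same_card_bij finite_Basis)
  have inj: "inj_on h Basis" and img: "h ` Basis = C"
    using h by (auto simp: bij_betw_def)
  define Q where "Q = (\<lambda>x::'a. \<Sum>b\<in>Basis. (x \<bullet> b) *\<^sub>R h b)"
  have nrm: "norm (h b) = 1" if "b \<in> Basis" for b
    using that img C(3) by auto
  have orth: "orthogonal (h b) (h c)" if "b \<in> Basis" "c \<in> Basis" "b \<noteq> c" for b c
    using that img C(2) inj by (metis image_eqI inj_on_contraD pairwiseD)
  have Q: "orthogonal_transformation Q"
    unfolding Q_def by (rule orthogonal_transformation_Basis_image(1)) (use nrm orth in auto)
  have Q_inner: "Q x \<bullet> h b = x \<bullet> b" if "b \<in> Basis" for x b
    unfolding Q_def by (rule orthogonal_transformation_Basis_image(2)) (use nrm orth that in auto)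
  have [measurable]: "Q \<in> borel_measurable borel"
    unfolding Q_def by measurable
  define J where "J = {b \<in> Basis. h b \<in> B}"
  have J: "finite J" "J \<subseteq> Basis" "h ` J = B" "inj_on h J"
    using C(1) img inj by (auto simp: J_def intro: inj_on_subset)
  have cardJ: "card J = n"
    using J by (metis card_image n_def)
  have "J \<noteq> {}" using J(3) B(3) by auto
  interpret N: product_prob_space "\<lambda>_::'a. std_normal"
    by (intro product_prob_spaceI prob_space_normal_density) simp
  have "emeasure std_gaussian {x. sqrt (\<Sum>v\<in>B. (x \<bullet> v)\<^sup>2) \<le> t}
      = emeasure (distr std_gaussian borel Q) {x. sqrt (\<Sum>v\<in>B. (x \<bullet> v)\<^sup>2) \<le> t}"
    by (simp add: distr_std_gaussian_orthogonal_transformation[OF Q])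
  also have "\<dots> = emeasure std_gaussian {x. sqrt (\<Sum>b\<in>J. (x \<bullet> b)\<^sup>2) \<le> t}"
  proof (subst emeasure_distr)
    have "(\<Sum>v\<in>B. (Q x \<bullet> v)\<^sup>2) = (\<Sum>b\<in>J. (x \<bullet> b)\<^sup>2)" for x
    proof -
      have "(\<Sum>v\<in>B. (Q x \<bullet> v)\<^sup>2) = (\<Sum>b\<in>J. (Q x \<bullet> h b)\<^sup>2)"
        using J(4) by (simp add: J(3)[symmetric] sum.reindex)
      also have "\<dots> = (\<Sum>b\<in>J. (x \<bullet> b)\<^sup>2)"
        using J(2) by (intro sum.cong refl) (simp add: Q_inner subset_iff)
      finally show ?thesis .
    qed
    thus "emeasure std_gaussian (Q -` {x. sqrt (\<Sum>v\<in>B. (x \<bullet> v)\<^sup>2) \<le> t} \<inter> space std_gaussian)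
        = emeasure std_gaussian {x. sqrt (\<Sum>b\<in>J. (x \<bullet> b)\<^sup>2) \<le> t}"
      by (simp add: vimage_def)
  qed measurable
  also have "\<dots> = emeasure (\<Pi>\<^sub>M b\<in>Basis. std_normal)
      ((\<lambda>f. restrict f J) -` {f \<in> space (\<Pi>\<^sub>M i\<in>J. lborel). sqrt (\<Sum>i\<in>J. (f i)\<^sup>2) \<le> t}
         \<inter> space (\<Pi>\<^sub>M b\<in>(Basis :: 'a set). std_normal))"
  proof -
    have [measurable]: "(\<lambda>f. \<Sum>b\<in>Basis. f b *\<^sub>R b :: 'a) \<in> borel_measurable (\<Pi>\<^sub>M b\<in>Basis. std_normal)"
      by measurable
    show ?thesis
      unfolding std_gaussian_eq_distr_PiM
      using J(2)
      by (subst emeasure_distr)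
         (auto intro!: arg_cong2[where f = emeasure] sum.cong arg_cong2[where f = "(\<le>)"]
           simp: space_PiM vimage_def subset_iff)
  qed
  \<comment> \<open>The law of the coordinates in \<open>J\<close> is the marginal of the full
    product, as all factors are probability measures.\<close>
  also have "\<dots> = emeasure (\<Pi>\<^sub>M i\<in>J. std_normal)
      {f \<in> space (\<Pi>\<^sub>M i\<in>J. lborel). sqrt (\<Sum>i\<in>J. (f i)\<^sup>2) \<le> t}"
  proof (subst N.distr_restrict[OF J(2) finite_Basis], subst emeasure_distr)
    show "(\<lambda>f. restrict f J) \<in> (\<Pi>\<^sub>M b\<in>Basis. std_normal) \<rightarrow>\<^sub>M (\<Pi>\<^sub>M i\<in>J. std_normal)"
      by (rule measurable_restrict_subset[OF J(2)])
    have "{f \<in> space (\<Pi>\<^sub>M i\<in>J. std_normal). sqrt (\<Sum>i\<in>J. (f i)\<^sup>2) \<le> t} \<in> sets (\<Pi>\<^sub>M i\<in>J. std_normal)"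
      by measurable
    thus "{f \<in> space (\<Pi>\<^sub>M i\<in>J. lborel). sqrt (\<Sum>i\<in>J. (f i)\<^sup>2) \<le> t} \<in> sets (\<Pi>\<^sub>M i\<in>J. std_normal)"
      by (simp add: space_PiM)
  qed simp
  also have "\<dots> \<le> ennreal (bound_const n * (1 + real n / 2 * exp (- (t\<^sup>2 / 2))) * (t / sqrt 2) ^ n)"
    using emeasure_PiM_std_normal_ball[OF J(1) \<open>J \<noteq> {}\<close> t] by (simp add: cardJ)
  finally show ?thesis .
qed

section \<open>Resampling a Gaussian matrix in one direction\<close>

text \<open>The rank-one matrix with column factor \<open>u\<close> and row factor \<open>g\<close>.
  For a unit vector \<open>u\<close>, adding \<open>outer u (g - u v* A)\<close> to \<open>A\<close>
  replaces its component along \<open>u\<close> by \<open>g\<close>.\<close>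

definition outer :: "real ^ 'm \<Rightarrow> real ^ 'n \<Rightarrow> real ^ 'n ^ 'm" where
  "outer u g = (\<chi> i. (u $ i) *\<^sub>R g)"

text \<open>So \<open>outer u\<close> is the adjoint of the map taking \<open>A\<close> to
  \<open>u v* A\<close>.\<close>

lemma inner_outer_right: "A \<bullet> outer u g = (u v* A) \<bullet> g"
proof -
  have "A \<bullet> outer u g = (\<Sum>i\<in>UNIV. \<Sum>j\<in>UNIV. A $ i $ j * (u $ i * g $ j))"
    by (simp add: outer_def inner_vec_def)
  also have "\<dots> = (\<Sum>j\<in>UNIV. \<Sum>i\<in>UNIV. A $ i $ j * (u $ i * g $ j))"
    by (rule sum.swap)
  also have "\<dots> = (u v* A) \<bullet> g"
    by (simp add: inner_vec_def vector_matrix_mult_def sum_distrib_left sum_distrib_right mult_ac)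
  finally show ?thesis .
qed

lemma vector_matrix_mult_outer: "v v* outer u g = (v \<bullet> u) *\<^sub>R g"
  by (simp add: vec_eq_iff outer_def vector_matrix_mult_def inner_vec_def sum_distrib_left sum_distrib_right mult_ac)

lemma vector_matrix_mult_add_right: "v v* (A + B) = v v* A + v v* (B :: real ^ 'n ^ 'm)"
  by (simp add: vec_eq_iff vector_matrix_mult_def sum.distrib algebra_simps)

lemma vector_matrix_mult_scaleR_right: "v v* (c *\<^sub>R A) = c *\<^sub>R (v v* (A :: real ^ 'n ^ 'm))"
  by (simp add: vec_eq_iff vector_matrix_mult_def sum_distrib_left mult_ac)

lemma linear_vector_matrix_mult_right: "linear (\<lambda>A :: real ^ 'n ^ 'm. v v* A)"
  by (intro linearI vector_matrix_mult_add_right vector_matrix_mult_scaleR_right)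

lemma linear_outer: "linear (outer u)"
  by (intro linearI) (simp_all add: vec_eq_iff outer_def algebra_simps)

text \<open>With \<open>a = u v* A\<close>, the matrix \<open>A\<close> is the orthogonal sum of
  \<open>outer u a\<close> and a remainder; the map exchanges \<open>a\<close> and \<open>g\<close>
  and keeps the remainder.\<close>

lemma orthogonal_transformation_resample:
  fixes u :: "real ^ 'm"
  assumes u: "norm u = 1"
  shows "orthogonal_transformation
    (\<lambda>(A :: real ^ 'n ^ 'm, g :: real ^ 'n). (A + outer u (g - u v* A), u v* A))"
proof -
  interpret O: linear "outer u :: real ^ 'n \<Rightarrow> real ^ 'n ^ 'm" by (rule linear_outer)
  interpret V: linear "\<lambda>A :: real ^ 'n ^ 'm. u v* A" by (rule linear_vector_matrix_mult_right)
  have uu: "u \<bullet> u = 1" using u by (simp add: norm_eq_1)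
  have "linear (\<lambda>(A :: real ^ 'n ^ 'm, g :: real ^ 'n). (A + outer u (g - u v* A), u v* A))"
    by (intro linearI) (auto simp: V.add V.scaleR O.add O.diff O.scaleR algebra_simps)
  moreover have "norm (A + outer u (g - u v* A), u v* A) = norm (A, g)"
    for A :: "real ^ 'n ^ 'm" and g :: "real ^ 'n"
  proof -
    define a where "a = u v* A"
    have "outer u (g - a) \<bullet> outer u (g - a) = (g - a) \<bullet> (g - a)"
      by (simp add: inner_outer_right vector_matrix_mult_outer uu)
    hence "(A + outer u (g - a)) \<bullet> (A + outer u (g - a)) = A \<bullet> A + 2 * (a \<bullet> (g - a)) + (g - a) \<bullet> (g - a)"
      using inner_outer_right[of A u "g - a"]
      by (simp add: inner_add_left inner_add_right inner_commute a_def)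
    also have "\<dots> = A \<bullet> A + g \<bullet> g - a \<bullet> a"
      by (simp add: inner_diff_left inner_diff_right inner_commute)
    finally have "(A + outer u (g - a), a) \<bullet> (A + outer u (g - a), a) = (A, g) \<bullet> (A, g)"
      by simp
    thus ?thesis
      by (simp add: norm_eq a_def)
  qed
  ultimately show ?thesis
    by (auto simp: orthogonal_transformation)
qed

text \<open>Draw \<open>g\<close> independently of \<open>A\<close>. By isometry invariance the
  resampled matrix has the same law as \<open>A\<close>, so the measure of \<open>F\<close> is an
  average over \<open>A\<close> of the conditional probabilities bounded in
  \<open>le\<close>.\<close>

lemma emeasure_std_gaussian_resample_le:
  fixes F :: "(real ^ 'n ^ 'm) set" and u :: "real ^ 'm"
  assumes u: "norm u = 1" and F: "F \<in> sets borel"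
    and le: "\<And>A. emeasure std_gaussian {g. A + outer u (g - u v* A) \<in> F} \<le> c"
  shows "emeasure std_gaussian F \<le> c"
proof -
  let ?M = "std_gaussian :: (real ^ 'n ^ 'm) measure" and ?N = "std_gaussian :: (real ^ 'n) measure"
  let ?P = "std_gaussian :: ((real ^ 'n ^ 'm) \<times> (real ^ 'n)) measure"
  interpret M: prob_space ?M by (rule prob_space_std_gaussian)
  interpret N: prob_space ?N by (rule prob_space_std_gaussian)
  define Q where "Q = (\<lambda>(A :: real ^ 'n ^ 'm, g :: real ^ 'n). (A + outer u (g - u v* A), u v* A))"
  have Q: "orthogonal_transformation Q"
    unfolding Q_def by (rule orthogonal_transformation_resample[OF u])
  have Qm: "Q \<in> borel_measurable borel"
    using orthogonal_transformation_linear[OF Q]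
    by (intro borel_measurable_continuous_onI linear_continuous_on)
       (simp add: linear_conv_bounded_linear)
  \<comment> \<open>The second factor \<open>UNIV\<close> discards the old component
    \<open>u v* A\<close> returned by \<open>Q\<close>.\<close>
  have FU: "F \<times> UNIV \<in> sets (?M \<Otimes>\<^sub>M ?N)"
    using F by (intro pair_measureI) auto
  have sets_P: "sets ?P = sets (?M \<Otimes>\<^sub>M ?N)"
    using arg_cong[OF std_gaussian_prod, of sets] .
  hence FU': "F \<times> UNIV \<in> sets (borel :: ((real ^ 'n ^ 'm) \<times> (real ^ 'n)) measure)"
    using FU by simp
  have QFU: "Q -` (F \<times> UNIV) \<in> sets (?M \<Otimes>\<^sub>M ?N)"
    using measurable_sets[OF Qm FU'] sets_P by simp
  have "emeasure ?M F = emeasure (?M \<Otimes>\<^sub>M ?N) (F \<times> UNIV)"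
    using F N.emeasure_space_1 by (subst N.emeasure_pair_measure_Times) auto
  also have "\<dots> = emeasure (distr ?P borel Q) (F \<times> UNIV)"
    by (simp only: distr_std_gaussian_orthogonal_transformation[OF Q]) (simp only: std_gaussian_prod)
  also have "\<dots> = emeasure (?M \<Otimes>\<^sub>M ?N) (Q -` (F \<times> UNIV))"
    using Qm FU' by (subst emeasure_distr) (auto simp: std_gaussian_prod[symmetric])
  also have "\<dots> = (\<integral>\<^sup>+A. emeasure ?N (Pair A -` (Q -` (F \<times> UNIV))) \<partial>?M)"
    by (rule N.emeasure_pair_measure_alt[OF QFU])
  also have "\<dots> \<le> (\<integral>\<^sup>+A. c \<partial>?M)"
    using le by (intro nn_integral_mono) (simp add: Q_def vimage_def)
  also have "\<dots> = c"
    using M.emeasure_space_1 by simp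
  finally show ?thesis .
qed

section \<open>Success of the reduced problem\<close>

text \<open>Independence makes the joint law of all \<open>Y i\<close> a product; \<open>h\<close>
  assigns to each basis vector its variable, and injectivity of \<open>h\<close> keeps the reindexed
  law a product.\<close>

lemma distr_eq_std_gaussian:
  fixes X :: "'w \<Rightarrow> 'a::euclidean_space" and h :: "'a \<Rightarrow> 'i::finite"
  assumes M: "prob_space M"
    and indep: "prob_space.indep_vars M (\<lambda>_. borel) Y UNIV"
    and distr: "\<And>i. distributed M lborel (Y i) std_normal_density"
    and h: "inj_on h Basis" and X: "\<And>\<omega> b. b \<in> Basis \<Longrightarrow> X \<omega> \<bullet> b = Y (h b) \<omega>"
  shows "distr M borel X = std_gaussian"
proof -
  interpret prob_space M by fact
  interpret N: product_prob_space "\<lambda>_::'i. std_normal"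
    by (intro product_prob_spaceI prob_space_normal_density) simp
  have Y [measurable]: "Y i \<in> borel_measurable M" for i
    using distr[of i] by (simp add: distributed_def)
  have Y_distr: "distr M borel (Y i) = std_normal" for i
    using distributed_distr_eq_density[OF distr[of i]] by (simp cong: distr_cong)
  have joint: "distr M (\<Pi>\<^sub>M i\<in>UNIV. borel) (\<lambda>\<omega>. \<lambda>i\<in>UNIV. Y i \<omega>) = (\<Pi>\<^sub>M i\<in>UNIV. std_normal)"
    using indep by (subst (asm) indep_vars_iff_distr_eq_PiM) (auto simp: Y_distr)
  have sets_eq: "sets (\<Pi>\<^sub>M b\<in>(Basis :: 'a set). std_normal) = sets (\<Pi>\<^sub>M b\<in>Basis. borel)"
    by (intro sets_PiM_cong) auto
  have "std_gaussian = distr (\<Pi>\<^sub>M b\<in>Basis. std_normal) borel (\<lambda>f. \<Sum>b\<in>Basis. f b *\<^sub>R b :: 'a)"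
    by (rule std_gaussian_eq_distr_PiM)
  also have "(\<Pi>\<^sub>M b\<in>Basis. std_normal)
      = distr (\<Pi>\<^sub>M i\<in>UNIV. std_normal) (\<Pi>\<^sub>M b\<in>Basis. std_normal) (\<lambda>f. \<lambda>b\<in>Basis. f (h b))"
    using h by (intro N.distr_reorder[symmetric]) auto
  also have "\<dots> = distr M (\<Pi>\<^sub>M b\<in>Basis. borel) (\<lambda>\<omega>. \<lambda>b\<in>Basis. Y (h b) \<omega>)"
    unfolding joint[symmetric]
    by (subst distr_distr) (auto simp: comp_def sets_eq cong: distr_cong)
  also have "distr \<dots> borel (\<lambda>f. \<Sum>b\<in>Basis. f b *\<^sub>R b) = distr M borel (\<lambda>\<omega>. \<Sum>b\<in>Basis. Y (h b) \<omega> *\<^sub>R b)"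
    by (subst distr_distr) (auto simp: comp_def)
  also have "(\<lambda>\<omega>. \<Sum>b\<in>Basis. Y (h b) \<omega> *\<^sub>R b) = X"
  proof
    fix \<omega>
    have "(\<Sum>b\<in>Basis. Y (h b) \<omega> *\<^sub>R b) = (\<Sum>b\<in>Basis. (X \<omega> \<bullet> b) *\<^sub>R b)"
      by (intro sum.cong refl) (simp only: X)
    thus "(\<Sum>b\<in>Basis. Y (h b) \<omega> *\<^sub>R b) = X \<omega>"
      by (simp only: euclidean_representation)
  qed
  finally show ?thesis ..
qed

lemma gaussian_matrix_distr:
  fixes A :: "'w \<Rightarrow> real ^ 'n ^ 'm"
  assumes "prob_space M" "gaussian_matrix M A"
  shows "distr M borel A = std_gaussian"
proof -
  \<comment> \<open>The matrix units form the standard basis of the nested vector type;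
    \<open>h\<close> reads off the index pair of a unit.\<close>
  let ?e = "\<lambda>(i, j). axis i (axis j 1) :: real ^ 'n ^ 'm"
  have e: "bij_betw ?e UNIV Basis"
    by (auto simp: bij_betw_def inj_on_def axis_eq_axis Basis_vec_def)
  define h where "h = the_inv_into UNIV ?e"
  have h: "bij_betw h Basis UNIV"
    unfolding h_def using e by (rule bij_betw_the_inv_into)
  show ?thesis
  proof (rule distr_eq_std_gaussian[where Y = "\<lambda>(i, j) \<omega>. A \<omega> $ i $ j" and h = h])
    fix \<omega> and b :: "real ^ 'n ^ 'm" assume "b \<in> Basis"
    then obtain i j where b: "b = ?e (i, j)"
      by (auto simp: Basis_vec_def)
    have "h b = (i, j)"
      using e unfolding h_def b by (intro the_inv_into_f_f) (auto simp: bij_betw_def)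
    thus "A \<omega> \<bullet> b = (\<lambda>(i, j) \<omega>. A \<omega> $ i $ j) (h b) \<omega>"
      by (simp add: b inner_axis)
  qed (use assms h in \<open>auto simp: gaussian_matrix_def bij_betw_def\<close>)
qed

text \<open>Supplies measurability of success. The pairs \<open>(y, A)\<close> attaining the minimum
  form a closed set, and projecting away a variable confined to a compact box preserves
  closedness.\<close>

lemma closed_reduced_problem_successful:
  fixes f :: "real ^ 'm \<Rightarrow> real"
  assumes "continuous_on UNIV f"
  shows "closed {A :: real ^ 'n ^ 'm. reduced_problem_successful f A \<delta>}"
proof -
  let ?K = "{y :: real ^ 'n. \<forall>j. y $ j \<in> {-\<delta>..\<delta>}}"
  have "?K = cbox (vec (-\<delta>)) (vec \<delta>)"
    by (auto simp: mem_box_cart)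
  hence K: "compact ?K" by simp
  have "continuous_on UNIV (\<lambda>(y :: real ^ 'n, A :: real ^ 'n ^ 'm). A *v y)"
    unfolding matrix_vector_mult_def split_def by (intro continuous_intros)
  hence "continuous_on UNIV (\<lambda>(y :: real ^ 'n, A :: real ^ 'n ^ 'm). f (A *v y))"
    using continuous_on_compose2[OF assms, of UNIV "\<lambda>(y :: real ^ 'n, A :: real ^ 'n ^ 'm). A *v y"]
    by (simp add: split_def)
  hence "closed {p. (\<lambda>(y :: real ^ 'n, A :: real ^ 'n ^ 'm). f (A *v y)) p = global_min f}"
    by (intro closed_Collect_eq continuous_on_const)
  from closed_compact_projection[OF K this] show ?thesis
    by (simp add: reduced_problem_successful_def Bex_def)
qed

text \<open>The minimizers form a nonempty closed set, so one of least norm exists. Its projection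
  to \<open>T\<close> has the same value, the discarded part being orthogonal to \<open>T\<close>,
  and no larger norm, so it is a least-norm minimizer as well.\<close>

lemma minimizer_in_subspace:
  fixes f :: "real ^ 'm \<Rightarrow> real"
  assumes cont: "continuous_on UNIV f" and min: "attains_global_min f" and T: "varies_only_along T f"
  obtains x where "x \<in> T" "f x = global_min f" "norm x = min_norm_minimizer f"
proof -
  obtain x0 where x0: "\<And>y. f x0 \<le> f y"
    using min by (auto simp: attains_global_min_def)
  have "global_min f = f x0"
    unfolding global_min_def using x0 by (intro Least_equality) auto
  hence "x0 \<in> global_minimizers f"
    by (simp add: global_minimizers_def)
  moreover have "closed (global_minimizers f)"
    unfolding global_minimizers_def using cont by (intro closed_Collect_eq continuous_on_const)
  ultimately obtain x1 where x1: "x1 \<in> global_minimizers f"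
    "\<And>y. y \<in> global_minimizers f \<Longrightarrow> norm x1 \<le> norm y"
    using distance_attains_inf[of "global_minimizers f" 0] by auto
  have \<mu>: "min_norm_minimizer f = norm x1"
    unfolding min_norm_minimizer_def using x1 by (intro Least_equality) auto
  have subT: "subspace T" and fT: "\<And>x y. x \<in> T \<Longrightarrow> y \<in> orthogonal_comp T \<Longrightarrow> f (x + y) = f x"
    using T by (auto simp: varies_only_along_def)
  obtain x y where xy: "x \<in> span T" "\<And>w. w \<in> span T \<Longrightarrow> orthogonal y w" "x1 = x + y"
    using orthogonal_subspace_decomp_exists[of T x1] by metis
  have x: "x \<in> T" using xy(1) subT by (simp add: span_eq_iff[THEN iffD2])
  have "y \<in> orthogonal_comp T"
    using xy(2) span_base by (auto simp: orthogonal_comp_def orthogonal_commute)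
  hence fx: "f x = f x1"
    using fT x xy(3) by simp
  hence "x \<in> global_minimizers f"
    using x1(1) by (simp add: global_minimizers_def)
  moreover have "norm x \<le> norm x1"
  proof -
    have "(norm x1)\<^sup>2 = (norm x)\<^sup>2 + (norm y)\<^sup>2"
      unfolding xy(3) using xy(1,2) by (intro norm_add_Pythagorean) (simp add: orthogonal_commute)
    hence "(norm x)\<^sup>2 \<le> (norm x1)\<^sup>2" by simp
    thus ?thesis by (rule power2_le_imp_le) simp
  qed
  ultimately have "norm x = norm x1"
    using x1(2) by (intro antisym) auto
  thus ?thesis
    using that[of x] x fx x1(1) \<mu> by (simp add: global_minimizers_def)
qed

text \<open>The vectors in \<open>B\<close> are orthogonal to the image under \<open>A\<^sup>T\<close> of the vectors of \<open>T\<close> orthogonal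
  to \<open>x\<close>. That image does not depend on \<open>g = A'\<^sup>T x / norm x\<close>, where \<open>A'\<close> is the resampled matrix;
  rescaling the projection of \<open>g\<close> onto the span of \<open>B\<close> solves \<open>A' y - x \<in> T\<^sup>\<bottom>\<close>.\<close>

lemma resampled_problem_successful:
  fixes A :: "real ^ 'n ^ 'm" and f :: "real ^ 'm \<Rightarrow> real"
  assumes T: "varies_only_along T f" and x: "x \<in> T" "f x = global_min f" "x \<noteq> 0"
    and dim: "dim T \<le> CARD('n)" and \<delta>: "\<delta> > 0"
  defines "u \<equiv> x /\<^sub>R norm x"
  obtains B :: "(real ^ 'n) set" where
    "pairwise orthogonal B" "\<And>v. v \<in> B \<Longrightarrow> norm v = 1" "card B = CARD('n) - dim T + 1"
    "\<And>g. norm x / \<delta> \<le> sqrt (\<Sum>v\<in>B. (g \<bullet> v)\<^sup>2) \<Longrightarrow>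
       reduced_problem_successful f (A + outer u (g - u v* A)) \<delta>"
proof -
  have subT: "subspace T" and fT: "\<And>x y. x \<in> T \<Longrightarrow> y \<in> orthogonal_comp T \<Longrightarrow> f (x + y) = f x"
    using T by (auto simp: varies_only_along_def)
  have u: "norm u = 1" "u \<in> T" "x = norm x *\<^sub>R u"
    using x subT by (auto simp: u_def subspace_scale)
  define T' where "T' = {v \<in> T. \<forall>w\<in>span {u}. orthogonal w v}"
  have subT': "subspace T'"
    unfolding T'_def
    by (intro subspaceI) (auto simp: subspace_0 subspace_add subspace_scale subT orthogonal_clauses)
  have "span {u} \<subseteq> T"
    using u(2) subT by (intro span_minimal) auto
  hence "dim T' + dim (span {u}) = dim T"
    unfolding T'_def by (rule dim_subspace_orthogonal_to_vectors[OF subspace_span subT])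
  moreover have "dim (span {u}) = 1"
    using u(1) by (auto simp: dim_singleton)
  ultimately have dimT': "dim T' + 1 = dim T" by simp
  define S where "S = (\<lambda>v. v v* A) ` T'"
  have lin: "linear (\<lambda>v. v v* A)"
    by (intro linearI) (simp_all add: vec_eq_iff vector_matrix_mult_def sum.distrib sum_distrib_left algebra_simps)
  have subS: "subspace S" and dimS: "dim S \<le> dim T'"
    unfolding S_def using lin subT' by (auto intro: linear_subspace_image dim_image_le)
  define W where "W = {y \<in> UNIV. \<forall>s\<in>S. orthogonal s y}"
  have subW: "subspace W"
    unfolding W_def by (auto simp: subspace_def orthogonal_clauses)
  have "dim W + dim S = dim (UNIV :: (real ^ 'n) set)"
    unfolding W_def by (intro dim_subspace_orthogonal_to_vectors subS) auto
  \<comment> \<open>The extra 1 comes from removing the direction \<open>u\<close> from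
    \<open>T\<close> before taking the image.\<close>
  hence "CARD('n) - dim T + 1 \<le> dim W"
    using dimS dimT' dim by (simp add: dim_UNIV)
  \<comment> \<open>\<open>W\<close> may be larger if \<open>A\<close> is degenerate on
    \<open>T'\<close>; a subspace of the exact dimension keeps the probability bound uniform in
    \<open>A\<close>.\<close>
  then obtain W' where W': "subspace W'" "W' \<subseteq> span W" "dim W' = CARD('n) - dim T + 1"
    by (rule choose_subspace_of_subspace)
  obtain B where B: "B \<subseteq> W'" "pairwise orthogonal B" "\<And>v. v \<in> B \<Longrightarrow> norm v = 1"
     "independent B" "card B = dim W'"
    using orthonormal_basis_subspace[OF W'(1)] by metis
  have BW: "v \<in> W" if "v \<in> B" for v
    using that B(1) W'(2) subW by (auto simp: span_eq_iff[THEN iffD2])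
  have finB: "finite B" using B(4) by (rule independent_imp_finite)
  show ?thesis
  proof (rule that[of B])
    fix g assume le: "norm x / \<delta> \<le> sqrt (\<Sum>v\<in>B. (g \<bullet> v)\<^sup>2)"
    define r where "r = sqrt (\<Sum>v\<in>B. (g \<bullet> v)\<^sup>2)"
    define p where "p = (\<Sum>v\<in>B. (g \<bullet> v) *\<^sub>R v)"
    \<comment> \<open>The scale is forced by \<open>g \<bullet> y = norm x\<close>, since
      \<open>g \<bullet> p = r^2\<close>; the norm of \<open>y\<close> is then
      \<open>norm x / r\<close>, at most \<delta>, so \<open>y\<close> lies in the box.\<close>
    define y where "y = (norm x / r\<^sup>2) *\<^sub>R p"
    have "0 < norm x / \<delta>" using x(3) \<delta> by simp
    hence r: "r > 0" "r\<^sup>2 = (\<Sum>v\<in>B. (g \<bullet> v)\<^sup>2)"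
      using le unfolding r_def by linarith (simp add: sum_nonneg)
    have "(norm p)\<^sup>2 = (\<Sum>v\<in>B. (norm ((g \<bullet> v) *\<^sub>R v))\<^sup>2)"
      unfolding p_def using B(2) finB
      by (intro norm_sum_Pythagorean) (auto simp: pairwise_def orthogonal_clauses)
    also have "\<dots> = r\<^sup>2"
      unfolding r(2) using B(3) by (intro sum.cong) auto
    finally have norm_p: "norm p = r"
      using r(1) by simp
    have "g \<bullet> p = r\<^sup>2"
      unfolding r(2) by (simp add: p_def inner_sum_right power2_eq_square)
    hence gy: "g \<bullet> y = norm x"
      using r(1) by (simp add: y_def)
    have "norm y = norm x / r"
      using r(1) by (simp add: y_def norm_p power2_eq_square)
    also have "\<dots> \<le> \<delta>"
      using le r(1) \<delta> by (simp add: r_def[symmetric] field_simps)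
    finally have "\<bar>y $ j\<bar> \<le> \<delta>" for j
      using component_le_norm_cart[of y j] by linarith
    hence y_box: "y \<in> {y. \<forall>j. y $ j \<in> {-\<delta>..\<delta>}}"
      by (simp add: abs_le_iff minus_le_iff)
    have "y \<in> W"
      unfolding y_def p_def using BW subW by (intro subspace_scale subspace_sum) auto
    hence yS: "s \<bullet> y = 0" if "s \<in> S" for s
      using that by (auto simp: W_def orthogonal_def)
    let ?A = "A + outer u (g - u v* A)"
    \<comment> \<open>Split \<open>v\<close> along \<open>u\<close>. The part in \<open>T'\<close>
      contributes nothing because \<open>y\<close> is orthogonal to \<open>S\<close>, and along
      \<open>u\<close> the new component \<open>g\<close> contributes exactly
      \<open>norm x\<close>.\<close>
    have "v \<bullet> (?A *v y - x) = 0" if v: "v \<in> T" for v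
    proof -
      define v' where "v' = v - (v \<bullet> u) *\<^sub>R u"
      have uu: "u \<bullet> u = 1" using u(1) by (simp add: norm_eq_1)
      have "v' \<bullet> u = 0" by (simp add: v'_def inner_diff_left uu)
      hence "v' \<in> T'"
        using v u(2) subT
        by (auto simp: T'_def v'_def span_singleton orthogonal_def inner_commute
              intro!: subspace_diff subspace_scale)
      hence "(v' v* A) \<bullet> y = 0"
        by (intro yS) (simp add: S_def)
      moreover have "v v* A = v' v* A + (v \<bullet> u) *\<^sub>R (u v* A)"
        using linear_add[OF lin, of v' "(v \<bullet> u) *\<^sub>R u"] linear_scale[OF lin, of "v \<bullet> u" u]
        by (simp add: v'_def)
      ultimately have "(v v* ?A) \<bullet> y = (v \<bullet> u) * norm x"
        by (simp add: vector_matrix_mult_add_right vector_matrix_mult_outer scaleR_diff_right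
            inner_add_left gy)
      moreover have "v \<bullet> x = (v \<bullet> u) * norm x"
        by (subst u(3)) simp
      ultimately show ?thesis
        by (simp add: inner_diff_right dot_lmul_matrix)
    qed
    hence "?A *v y - x \<in> orthogonal_comp T"
      by (auto simp: orthogonal_comp_def orthogonal_def)
    hence "f (?A *v y) = global_min f"
      using fT[OF x(1), of "?A *v y - x"] x(2) by simp
    thus "reduced_problem_successful f ?A \<delta>"
      unfolding reduced_problem_successful_def using y_box by blast
  qed (use B W' in auto)
qed

theorem corollary4p2:
  fixes f :: "real ^ 'D \<Rightarrow> real"
    and d\<^sub>e :: nat
    and M :: "'w measure"
    and A :: "'w \<Rightarrow> real ^ 'd ^ 'D"
    and \<delta> :: real
  defines "\<mu> \<equiv> min_norm_minimizer f"
    and "n \<equiv> CARD('d) - d\<^sub>e + 1"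
  assumes "continuous_on UNIV f"
    and "attains_global_min f"
    and "has_effective_dimensionality f d\<^sub>e"
    and "d\<^sub>e \<le> CARD('d)"
    and "prob_space M"
    and "gaussian_matrix M A"
    and "\<delta> > 0"
  shows "measure M {\<omega> \<in> space M. reduced_problem_successful f (A \<omega>) \<delta>} \<ge>
           1 - bound_const n * (1 + real n / 2 * exp (- (\<mu>\<^sup>2 / (2 * \<delta>\<^sup>2)))) *
             (\<mu> / (sqrt 2 * \<delta>)) ^ n"
proof -
  interpret prob_space M by fact
  obtain T where T: "varies_only_along T f" "dim T = d\<^sub>e"
    using assms by (auto simp: has_effective_dimensionality_def)
  obtain x where x: "x \<in> T" "f x = global_min f" "norm x = \<mu>"
    using minimizer_in_subspace[OF \<open>continuous_on UNIV f\<close> \<open>attains_global_min f\<close> T(1)]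
    unfolding \<mu>_def by metis
  show ?thesis
  proof (cases "x = 0")
    \<comment> \<open>A minimizer at the origin is reached by \<open>y = 0\<close> for every matrix;
      the bound is then 1 because \<mu> is 0 and \<open>n\<close> is positive.\<close>
    case True
    have "reduced_problem_successful f (A \<omega>) \<delta>" for \<omega>
      unfolding reduced_problem_successful_def
      using True x(2) \<open>\<delta> > 0\<close> by (intro bexI[of _ 0]) auto
    thus ?thesis
      using True x(3) by (simp add: n_def prob_space)
  next
    case False
    define t where "t = \<mu> / \<delta>"
    define u where "u = x /\<^sub>R norm x"
    define b where "b = bound_const n * (1 + real n / 2 * exp (- (t\<^sup>2 / 2))) * (t / sqrt 2) ^ n"
    define F where "F = {A :: real ^ 'd ^ 'D. \<not> reduced_problem_successful f A \<delta>}"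
    have t: "t > 0" using False x(3) \<open>\<delta> > 0\<close> by (auto simp: t_def)
    \<comment> \<open>Nonnegativity is needed to pass from the \<open>ennreal\<close> bound back to
      real probabilities.\<close>
    have b: "b \<ge> 0"
      unfolding b_def bound_const_def n_def using t
      by (intro mult_nonneg_nonneg divide_nonneg_nonneg add_nonneg_nonneg Gamma_real_nonneg) auto
    have "open F"
      using closed_reduced_problem_successful[OF \<open>continuous_on UNIV f\<close>, of \<delta>, where 'n = 'd]
      by (simp add: F_def closed_def Collect_neg_eq)
    hence F: "F \<in> sets borel" by simp
    \<comment> \<open>For a fixed matrix \<open>B\<close>, failure after resampling confines the
      projection of \<open>g\<close> onto a fixed \<open>n\<close>-dimensional subspace to the ball
      of radius \<open>t\<close>.\<close>
    have le: "emeasure std_gaussian {g. B + outer u (g - u v* B) \<in> F} \<le> ennreal b"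
      for B :: "real ^ 'd ^ 'D"
    proof -
      obtain C :: "(real ^ 'd) set" where C: "pairwise orthogonal C" "\<And>v. v \<in> C \<Longrightarrow> norm v = 1" "card C = n"
        "\<And>g. t \<le> sqrt (\<Sum>v\<in>C. (g \<bullet> v)\<^sup>2) \<Longrightarrow> B + outer u (g - u v* B) \<notin> F"
        using resampled_problem_successful[OF T(1) x(1,2) False _ \<open>\<delta> > 0\<close>, where A = B]
          \<open>d\<^sub>e \<le> CARD('d)\<close>
        unfolding T(2) x(3) n_def t_def u_def F_def mem_Collect_eq not_not by metis
      have "C \<noteq> {}" using C(3) by (auto simp: n_def)
      have "sqrt (\<Sum>v\<in>C. (g \<bullet> v)\<^sup>2) \<le> t" if "B + outer u (g - u v* B) \<in> F" for g
        using C(4)[of g] that by linarith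
      hence "emeasure std_gaussian {g. B + outer u (g - u v* B) \<in> F}
          \<le> emeasure std_gaussian {g. sqrt (\<Sum>v\<in>C. (g \<bullet> v)\<^sup>2) \<le> t}"
        by (intro emeasure_mono) auto
      also have "\<dots> \<le> ennreal b"
        using emeasure_std_gaussian_projection_le[OF C(1,2) \<open>C \<noteq> {}\<close> t] by (simp add: b_def C(3))
      finally show ?thesis .
    qed
    have law: "distr M borel A = std_gaussian"
      by (rule gaussian_matrix_distr) fact+
    have A: "A \<in> borel_measurable M"
    proof -
      have "(\<lambda>\<omega>. A \<omega> $ i $ j) \<in> borel_measurable M" for i j
        using \<open>gaussian_matrix M A\<close> by (auto simp: gaussian_matrix_def distributed_def)
      thus ?thesis
        by (subst borel_measurable_euclidean_space) (auto simp: Basis_vec_def inner_axis)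
    qed
    have AF: "A -` F \<inter> space M \<in> events"
      using A F by (rule measurable_sets)
    have "emeasure M (A -` F \<inter> space M) = emeasure std_gaussian F"
      using A F by (simp add: law[symmetric] emeasure_distr)
    also have "\<dots> \<le> ennreal b"
      using False by (intro emeasure_std_gaussian_resample_le[of u] F le) (simp add: u_def)
    finally have "prob (A -` F \<inter> space M) \<le> b"
      using b by (simp add: emeasure_eq_measure)
    moreover have "{\<omega> \<in> space M. reduced_problem_successful f (A \<omega>) \<delta>} = space M - (A -` F \<inter> space M)"
      by (auto simp: F_def)
    ultimately have "prob {\<omega> \<in> space M. reduced_problem_successful f (A \<omega>) \<delta>} \<ge> 1 - b"
      using AF by (simp add: prob_compl)
    moreover have "t\<^sup>2 / 2 = \<mu>\<^sup>2 / (2 * \<delta>\<^sup>2)" "t / sqrt 2 = \<mu> / (sqrt 2 * \<delta>)"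
      by (simp_all add: t_def power_divide mult.commute)
    ultimately show ?thesis
      by (simp add: b_def)
  qed
qed

end
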